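(* If $G$ is a connected bipartite graph of even size, then $\chi'_{\rm irr}(G)\leq 9$.
   Context: All graphs are finite and simple. The size of a graph is its number of edges. A graph is locally irregular if any two adjacent vertices have distinct degrees. $\chi'_{\rm irr}(G)$ denotes the least number of colours in an edge-colouring of $G$ in which, for each colour, the subgraph formed by the edges of that colour is locally irregular. *)

theory Defs
  imports Main "HOL-Library.Extended_Nat"
begin

locale fin_simple_graph =
  fixes V :: "'a set" and E :: "'a set set"
  assumes finite_vertices: "finite V"
    and edges: "\<And>e. e \<in> E \<Longrightarrow> e \<subseteq> V \<and> card e = 2"

definition graph_connected :: "'a set \<Rightarrow> 'a set set \<Rightarrow> bool" where
  "graph_connected V E \<longleftrightarrow>
     V \<noteq> {} \<and> (\<forall>u\<in>V. \<forall>v\<in>V. (u, v) \<in> {(x, y). {x, y} \<in> E}\<^sup>*)"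

definition graph_bipartite :: "'a set \<Rightarrow> 'a set set \<Rightarrow> bool" where
  "graph_bipartite V E \<longleftrightarrow>
     (\<exists>A B. A \<union> B = V \<and> A \<inter> B = {} \<and> (\<forall>e\<in>E. \<exists>a\<in>A. \<exists>b\<in>B. e = {a, b}))"

definition degree :: "'a set set \<Rightarrow> 'a \<Rightarrow> nat" where
  "degree E v = card {e \<in> E. v \<in> e}"

text \<open>Isolated vertices are irrelevant for local irregularity, so a subgraph is given by
  its edge set alone.\<close>

definition locally_irregular :: "'a set set \<Rightarrow> bool" where
  "locally_irregular E \<longleftrightarrow> (\<forall>u v. {u, v} \<in> E \<longrightarrow> degree E u \<noteq> degree E v)"

text \<open>The colouring need not be proper, and not all of the \<open>k\<close> colours need be used.\<close>

definition locally_irregular_colouring ::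
    "'a set set \<Rightarrow> nat \<Rightarrow> ('a set \<Rightarrow> nat) \<Rightarrow> bool" where
  "locally_irregular_colouring E k c \<longleftrightarrow>
     (\<forall>e\<in>E. c e < k) \<and> (\<forall>i<k. locally_irregular {e \<in> E. c e = i})"

text \<open>Some graphs (such as a single edge) have no such colouring; their index is \<open>\<infinity>\<close>,
  the infimum of the empty set in \<^typ>\<open>enat\<close>.\<close>

definition irr_chromatic_index :: "'a set set \<Rightarrow> enat" where
  "irr_chromatic_index E = (INF k \<in> {k. \<exists>c. locally_irregular_colouring E k c}. enat k)"

end

theory Submission imports Defs begin

text \<open>
  A bipartite graph is given by its set of pairs (left end, right end). If all left degrees are
  even and all nonzero right degrees are odd, the graph is locally irregular, and all nine colour
  classes will have this form (two of them with the sides exchanged).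

  \<^item> A forest with even left degrees needs 2 colours: give the star of each left vertex one
    colour, chosen from the root downwards so that every right vertex of odd degree sees one colour
    and every right vertex of even degree sees one of the colours exactly once.
  \<^item> In a connected graph, choose a minimal edge set whose degrees are odd exactly at the left
    vertices of odd degree. It is a forest with even right degrees (2 colours), and all remaining
    left degrees are even.
  \<^item> A connected graph with even left degrees needs 7 colours. If the number of right vertices is
    even, let \<open>T\<close> be a maximal subgraph with even left degrees and odd degree at every right vertex;
    its complement is a forest. Otherwise let \<open>T\<close> be such a subgraph after deletion of a right vertex
    \<open>v\<close> that does not disconnect the graph. Extending every edge at \<open>v\<close> to a path of length 2 gives
    a subdivided star, which needs 4 colours, and what remains besides \<open>T\<close> is again a forest.
\<close>

section \<open>Degree parities in bipartite graphs\<close>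

definition odd_verts :: "('a \<times> 'b) set \<Rightarrow> 'a set" where
  "odd_verts H = {a. odd (card (H `` {a}))}"

definition even_odd :: "('a \<times> 'b) set \<Rightarrow> bool" where
  "even_odd H \<longleftrightarrow> odd_verts H = {} \<and> odd_verts (H\<inverse>) = Range H"

text \<open>The property \<open>P\<close> is a parameter because the notion serves for
  \<open>even_odd\<close> on sets of pairs and, at the end, for \<open>locally_irregular\<close> on
  edge sets.\<close>

definition decomposable :: "('e set \<Rightarrow> bool) \<Rightarrow> nat \<Rightarrow> 'e set \<Rightarrow> bool" where
  "decomposable P k H \<longleftrightarrow>
     (\<exists>c. (\<forall>e\<in>H. c e < k) \<and> (\<forall>i<k. P {e \<in> H. c e = i}))"

text \<open>For finite \<open>H\<close> this says that \<open>H\<close> has no cycle; the form below avoids paths altogether.\<close>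

definition forest :: "('a \<times> 'b) set \<Rightarrow> bool" where
  "forest H \<longleftrightarrow> (\<forall>Z\<subseteq>H. odd_verts Z = {} \<and> odd_verts (Z\<inverse>) = {} \<longrightarrow> Z = {})"

lemma finite_Image_singleton [simp]: "finite H \<Longrightarrow> finite (H `` {a})"
  by (rule finite_subset[of _ "Range H"]) (auto intro: finite_Range)

lemma odd_card_sym_diff:
  assumes "finite X" "finite Y"
  shows "odd (card (sym_diff X Y)) \<longleftrightarrow> odd (card X) \<noteq> odd (card Y)"
proof -
  have "card (sym_diff X Y) = card (X - Y) + card (Y - X)"
    using assms by (intro card_Un_disjoint) auto
  moreover have "card X = card (X - Y) + card (X \<inter> Y)" "card Y = card (Y - X) + card (X \<inter> Y)"
    using assms by (metis card_Int_Diff add.commute inf.commute)+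
  ultimately show ?thesis by presburger
qed

lemma odd_verts_sym_diff:
  assumes "finite X" "finite Y"
  shows "odd_verts (sym_diff X Y) = sym_diff (odd_verts X) (odd_verts Y)"
proof -
  have "sym_diff X Y `` {a} = sym_diff (X `` {a}) (Y `` {a})" for a by auto
  then show ?thesis
    using assms by (auto simp: odd_verts_def odd_card_sym_diff)
qed

lemma odd_verts_Un_disjoint:
  assumes "finite X" "finite Y" "X \<inter> Y = {}"
  shows "odd_verts (X \<union> Y) = sym_diff (odd_verts X) (odd_verts Y)"
proof -
  have "X \<union> Y = sym_diff X Y" using assms(3) by auto
  then show ?thesis by (metis assms(1,2) odd_verts_sym_diff)
qed

lemma odd_verts_Diff:
  assumes "finite X" "Y \<subseteq> X"
  shows "odd_verts (X - Y) = sym_diff (odd_verts X) (odd_verts Y)"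
proof -
  have "X - Y = sym_diff X Y" using assms(2) by auto
  then show ?thesis by (metis assms finite_subset odd_verts_sym_diff)
qed

lemma odd_verts_empty [simp]: "odd_verts {} = {}"
  by (simp add: odd_verts_def)

lemma odd_verts_subset: "odd_verts H \<subseteq> Domain H"
proof
  fix a assume "a \<in> odd_verts H"
  then have "H `` {a} \<noteq> {}" by (auto simp: odd_verts_def)
  then show "a \<in> Domain H" by auto
qed

lemma card_eq_sum_degrees:
  assumes "finite H"
  shows "card H = (\<Sum>a\<in>Domain H. card (H `` {a}))"
proof -
  have "H = (SIGMA a:Domain H. H `` {a})" by auto
  then have "card H = card (SIGMA a:Domain H. H `` {a})" by (rule arg_cong)
  also have "\<dots> = (\<Sum>a\<in>Domain H. card (H `` {a}))"
    using assms by (intro card_SigmaI) (auto intro: finite_Domain)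
  finally show ?thesis .
qed

text \<open>Handshaking on one side: the left degrees sum to the number of edges, and modulo 2 only
  the odd ones count.\<close>

lemma even_card_odd_verts:
  assumes "finite H"
  shows "even (card (odd_verts H)) \<longleftrightarrow> even (card H)"
proof -
  have "odd_verts H = {a \<in> Domain H. odd (card (H `` {a}))}"
    using odd_verts_subset[of H] by (auto simp: odd_verts_def)
  then show ?thesis
    using assms by (simp add: card_eq_sum_degrees even_sum_iff finite_Domain)
qed

lemma even_card_odd_verts_converse:
  assumes "finite H"
  shows "even (card (odd_verts (H\<inverse>))) \<longleftrightarrow> even (card H)"
  using even_card_odd_verts[of "H\<inverse>"] assms by (simp add: card_inverse)

section \<open>Forests and colourings of their stars\<close>

lemma forest_subset: "forest H \<Longrightarrow> F \<subseteq> H \<Longrightarrow> forest F"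
  unfolding forest_def by (meson subset_trans)

text \<open>If all degrees were at least 2, there would be at least as many edges as vertices. But in a forest
  the map from edge sets to their pairs of odd-degree sets is injective, and by the handshake lemma
  it is not onto all pairs of vertex sets.\<close>

lemma forest_has_leaf:
  fixes F :: "('a \<times> 'b) set"
  assumes "finite F" "forest F" "F \<noteq> {}"
    and R: "\<And>b. b \<in> Range F \<Longrightarrow> card (F\<inverse> `` {b}) \<ge> 2"
  shows "\<exists>a\<in>Domain F. card (F `` {a}) = 1"
proof (rule ccontr)
  assume no: "\<not> ?thesis"
  have L: "card (F `` {a}) \<ge> 2" if "a \<in> Domain F" for a
  proof -
    have "card (F `` {a}) \<noteq> 0" using assms(1) that by auto
    moreover have "card (F `` {a}) \<noteq> 1" using no that by auto
    ultimately show ?thesis by linarith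
  qed
  have fin: "finite (Domain F)" "finite (Range F)"
    using assms(1) by (auto intro: finite_Domain finite_Range)
  have "(\<Sum>a\<in>Domain F. 2) \<le> card F"
    unfolding card_eq_sum_degrees[OF assms(1)] by (rule sum_mono) (use L in auto)
  moreover have "(\<Sum>b\<in>Domain (F\<inverse>). 2) \<le> card (F\<inverse>)"
    unfolding card_eq_sum_degrees[OF finite_converse[THEN iffD2, OF assms(1)]]
    by (rule sum_mono) (use R in auto)
  ultimately have le: "card (Domain F) + card (Range F) \<le> card F"
    by (simp add: card_inverse)
  define g where "g Z = (odd_verts Z, odd_verts (Z\<inverse>))" for Z :: "('a \<times> 'b) set"
  have inj: "inj_on g (Pow F)"
  proof (rule inj_onI)
    fix X Y assume XY: "X \<in> Pow F" "Y \<in> Pow F" "g X = g Y"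
    then have f: "finite X" "finite Y" using assms(1) finite_subset by auto
    have "(sym_diff X Y)\<inverse> = sym_diff (X\<inverse>) (Y\<inverse>)" by auto
    then have "odd_verts (sym_diff X Y) = {} \<and> odd_verts ((sym_diff X Y)\<inverse>) = {}"
      using XY f by (simp add: odd_verts_sym_diff g_def)
    moreover have "sym_diff X Y \<subseteq> F" using XY by auto
    ultimately have "sym_diff X Y = {}" using assms(2) unfolding forest_def by blast
    then show "X = Y" by auto
  qed
  obtain a where a: "a \<in> Domain F" using assms(3) by auto
  \<comment> \<open>The numbers of odd vertices on the two sides both have the parity of the number
    of edges, so one against none never occurs.\<close>
  have "({a}, {}) \<notin> g ` Pow F"
  proof
    assume "({a}, {}) \<in> g ` Pow F"
    then obtain Z where Z: "Z \<subseteq> F" "odd_verts Z = {a}" "odd_verts (Z\<inverse>) = {}"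
      by (auto simp: g_def)
    then have "finite Z" using assms(1) finite_subset by blast
    from even_card_odd_verts[OF this] even_card_odd_verts_converse[OF this] Z(2,3)
    show False by simp
  qed
  moreover have "g ` Pow F \<subseteq> Pow (Domain F) \<times> Pow (Range F)"
  proof -
    have "odd_verts Z \<subseteq> Domain F" "odd_verts (Z\<inverse>) \<subseteq> Range F" if "Z \<subseteq> F" for Z
      using odd_verts_subset[of Z] odd_verts_subset[of "Z\<inverse>"]
        Domain_mono[OF that] Range_mono[OF that] by auto
    then show ?thesis by (intro image_subsetI) (simp add: g_def)
  qed
  ultimately have "g ` Pow F \<subset> Pow (Domain F) \<times> Pow (Range F)" using a by blast
  then have "card (g ` Pow F) < card (Pow (Domain F) \<times> Pow (Range F))"
    using fin by (intro psubset_card_mono) auto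
  then have "(2::nat) ^ card F < 2 ^ (card (Domain F) + card (Range F))"
    using inj fin assms(1) by (simp add: card_image card_Pow card_cartesian_product power_add)
  then show False using le by simp
qed

text \<open>The predicate \<open>p\<close> prescribes the wanted parity of degrees. It is kept separate from \<open>F\<close> because
  the induction removes stars and thereby changes the degrees.\<close>

lemma forest_star_colouring:
  fixes F :: "('a \<times> 'b) set" and p :: "'b \<Rightarrow> bool"
  assumes "finite F" "forest F"
  shows "\<exists>x. \<forall>b\<in>Range F. \<exists>a0. (a0, b) \<in> F \<and>
           (\<forall>a. (a, b) \<in> F \<and> a \<noteq> a0 \<longrightarrow> (x a \<longleftrightarrow> (x a0 \<longleftrightarrow> p b)))"
  using assms
proof (induction "card F" arbitrary: F rule: less_induct)
  case less
  show ?case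
  proof (cases "F = {}")
    case False
    \<comment> \<open>The right leaves are dropped. If edges remain, \<open>forest_has_leaf\<close>
      yields a left vertex \<open>a\<close> of degree 1 in \<open>F'\<close>: all but one of its
      neighbours in \<open>F\<close> are leaves. Otherwise any left vertex will do.\<close>
    define F' where "F' = {(a, b) \<in> F. card (F\<inverse> `` {b}) \<ge> 2}"
    have F'F: "F' \<subseteq> F" by (auto simp: F'_def)
    have "\<exists>a\<in>Domain F. \<forall>b b'. (a, b) \<in> F' \<and> (a, b') \<in> F' \<longrightarrow> b = b'"
    proof (cases "F' = {}")
      case True
      with \<open>F \<noteq> {}\<close> show ?thesis by auto
    next
      case F': False
      have "card (F'\<inverse> `` {b}) \<ge> 2" if "b \<in> Range F'" for b
      proof -
        have "F'\<inverse> `` {b} = F\<inverse> `` {b}" using that by (auto simp: F'_def)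
        then show ?thesis using that by (auto simp: F'_def)
      qed
      moreover have "finite F'" "forest F'"
        using F'F less.prems by (auto intro: finite_subset forest_subset)
      ultimately obtain a where "a \<in> Domain F'" "card (F' `` {a}) = 1"
        using forest_has_leaf[OF _ _ F'] by blast
      then obtain b0 where "F' `` {a} = {b0}" by (metis card_1_singletonE)
      then have "\<And>b. (a, b) \<in> F' \<Longrightarrow> b = b0" by blast
      then show ?thesis using F'F \<open>a \<in> Domain F'\<close> by blast
    qed
    then obtain a where a: "a \<in> Domain F"
      and one: "\<And>b b'. (a, b) \<in> F' \<Longrightarrow> (a, b') \<in> F' \<Longrightarrow> b = b'" by blast
    define G where "G = {e \<in> F. fst e \<noteq> a}"
    obtain b1 where "(a, b1) \<in> F" using a by (rule DomainE)
    then have GF: "G \<subset> F"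
      by (intro psubsetI) (simp add: G_def, metis (mono_tags, lifting) G_def fst_conv mem_Collect_eq)
    have "card G < card F" by (rule psubset_card_mono[OF less.prems(1) GF])
    moreover have "finite G" "forest G"
      using less.prems GF by (auto intro: finite_subset forest_subset)
    ultimately obtain x where x: "\<And>b. b \<in> Range G \<Longrightarrow> \<exists>a0. (a0, b) \<in> G \<and>
           (\<forall>a. (a, b) \<in> G \<and> a \<noteq> a0 \<longrightarrow> (x a \<longleftrightarrow> (x a0 \<longleftrightarrow> p b)))"
      using less.hyps[of G] by blast
    \<comment> \<open>A neighbour of \<open>a\<close> that survives in \<open>G\<close> is no leaf
      of \<open>F\<close>, so by \<open>one\<close> there is at most one: the colour of
      \<open>a\<close>, chosen last, has at most one constraint to meet.\<close>
    have touch: "(a, b) \<in> F'" if "(a, b) \<in> F" "b \<in> Range G" for b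
    proof -
      obtain a' where "(a', b) \<in> F" "a' \<noteq> a" using \<open>b \<in> Range G\<close> by (auto simp: G_def)
      then have "card {a, a'} \<le> card (F\<inverse> `` {b})"
        using that less.prems by (intro card_mono) auto
      then show ?thesis using that \<open>a' \<noteq> a\<close> by (simp add: F'_def)
    qed
    obtain y where y: "\<And>b. (a, b) \<in> F \<Longrightarrow> b \<in> Range G \<Longrightarrow> \<exists>a0. (a0, b) \<in> G \<and>
           (\<forall>a. (a, b) \<in> G \<and> a \<noteq> a0 \<longrightarrow> (x a \<longleftrightarrow> (x a0 \<longleftrightarrow> p b))) \<and> (y \<longleftrightarrow> (x a0 \<longleftrightarrow> p b))"
    proof (cases "\<exists>b. (a, b) \<in> F \<and> b \<in> Range G")
      case True
      then obtain b where b: "(a, b) \<in> F" "b \<in> Range G" by blast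
      from x[OF b(2)] obtain a0 where a0: "(a0, b) \<in> G"
           "(\<forall>a. (a, b) \<in> G \<and> a \<noteq> a0 \<longrightarrow> (x a \<longleftrightarrow> (x a0 \<longleftrightarrow> p b)))" by blast
      show ?thesis
      proof (rule that[of "x a0 \<longleftrightarrow> p b"])
        fix b' assume "(a, b') \<in> F" "b' \<in> Range G"
        then have "b' = b" using one touch b by metis
        then show "\<exists>a0'. (a0', b') \<in> G \<and>
            (\<forall>a. (a, b') \<in> G \<and> a \<noteq> a0' \<longrightarrow> (x a \<longleftrightarrow> (x a0' \<longleftrightarrow> p b'))) \<and>
            ((x a0 \<longleftrightarrow> p b) \<longleftrightarrow> (x a0' \<longleftrightarrow> p b'))"
          using a0 by (intro exI[of _ a0]) simp
      qed
    next
      case False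
      \<comment> \<open>No neighbour of \<open>a\<close> survives, so its colour is
        arbitrary.\<close>
      then show ?thesis using that[of True] by metis
    qed
    have "\<exists>a0. (a0, b) \<in> F \<and> (\<forall>a'. (a', b) \<in> F \<and> a' \<noteq> a0 \<longrightarrow>
            ((x(a := y)) a' \<longleftrightarrow> ((x(a := y)) a0 \<longleftrightarrow> p b)))" if b: "b \<in> Range F" for b
    proof (cases "b \<in> Range G")
      case False
      then have "\<And>a'. (a', b) \<in> F \<Longrightarrow> a' = a" by (auto simp: G_def)
      then show ?thesis using b by blast
    next
      case True
      obtain a0 where a0: "(a0, b) \<in> G" and
        rest: "\<And>a. (a, b) \<in> G \<Longrightarrow> a \<noteq> a0 \<Longrightarrow> (x a \<longleftrightarrow> (x a0 \<longleftrightarrow> p b))" and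
        ya: "(a, b) \<in> F \<Longrightarrow> (y \<longleftrightarrow> (x a0 \<longleftrightarrow> p b))"
      proof (cases "(a, b) \<in> F")
        case inF: True
        show thesis using y[OF inF True] that by blast
      next
        case False
        then show thesis using x[OF True] that by blast
      qed
      have "(a0, b) \<in> F" "a0 \<noteq> a" using a0 by (auto simp: G_def)
      moreover have "(a', b) \<in> G" if "(a', b) \<in> F" "a' \<noteq> a" for a'
        using that by (simp add: G_def)
      ultimately show ?thesis using rest ya by (intro exI[of _ a0]) auto
    qed
    then show ?thesis by (intro exI[of _ "x(a := y)"]) blast
  qed simp
qed

section \<open>Decompositions into classes with a given property\<close>

lemma even_odd_empty [simp]: "even_odd {}"
  by (simp add: even_odd_def)

lemma decomposable_1: "P H \<Longrightarrow> decomposable P 1 H"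
  unfolding decomposable_def by (intro exI[of _ "\<lambda>_. 0"]) simp

lemma decomposable_empty: "P {} \<Longrightarrow> decomposable P k {}"
  unfolding decomposable_def by simp

lemma decomposable_Un:
  assumes "decomposable P j X" "decomposable P k Y" "X \<inter> Y = {}"
  shows "decomposable P (j + k) (X \<union> Y)"
proof -
  obtain c d where c: "\<forall>e\<in>X. c e < j" "\<forall>i<j. P {e \<in> X. c e = i}"
    and d: "\<forall>e\<in>Y. d e < k" "\<forall>i<k. P {e \<in> Y. d e = i}"
    using assms unfolding decomposable_def by blast
  define g where "g e = (if e \<in> X then c e else j + d e)" for e
  have "P {e \<in> X \<union> Y. g e = i}" if "i < j + k" for i
  proof (cases "i < j")
    case True
    then have "{e \<in> X \<union> Y. g e = i} = {e \<in> X. c e = i}"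
      unfolding g_def by auto
    then show ?thesis using c True by simp
  next
    case False
    then have "{e \<in> X \<union> Y. g e = i} = {e \<in> Y. d e = i - j}"
      using c(1) assms(3) unfolding g_def by auto
    then show ?thesis using d False that by simp
  qed
  moreover have "\<forall>e\<in>X \<union> Y. g e < j + k"
    using c(1) d(1) unfolding g_def by auto
  ultimately show ?thesis unfolding decomposable_def by blast
qed

lemma odd_verts_Un_vertex_disjoint:
  assumes "Domain X \<inter> Domain Y = {}"
  shows "odd_verts (X \<union> Y) = odd_verts X \<union> odd_verts Y"
proof -
  have "odd (card ((X \<union> Y) `` {a})) \<longleftrightarrow> odd (card (X `` {a})) \<or> odd (card (Y `` {a}))" for a
  proof -
    have "X `` {a} = {} \<or> Y `` {a} = {}" using assms by auto
    then show ?thesis by (auto simp: Un_Image)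
  qed
  then show ?thesis unfolding odd_verts_def by blast
qed

lemma even_odd_Un_vertex_disjoint:
  assumes "even_odd X" "even_odd Y" "Domain X \<inter> Domain Y = {}" "Range X \<inter> Range Y = {}"
  shows "even_odd (X \<union> Y)"
  using assms odd_verts_Un_vertex_disjoint[of X Y] odd_verts_Un_vertex_disjoint[of "X\<inverse>" "Y\<inverse>"]
  by (simp add: even_odd_def converse_Un Range_Un_eq)

text \<open>Unlike in \<open>decomposable_Un\<close>, the colours are reused: the parts share no
  vertex, so merging classes changes no nonzero degree.\<close>

lemma decomposable_Un_vertex_disjoint:
  assumes "decomposable even_odd k X" "decomposable even_odd k Y"
    and dom: "Domain X \<inter> Domain Y = {}" and ran: "Range X \<inter> Range Y = {}"
  shows "decomposable even_odd k (X \<union> Y)"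
proof -
  obtain c d where c: "\<forall>e\<in>X. c e < k" "\<forall>i<k. even_odd {e \<in> X. c e = i}"
    and d: "\<forall>e\<in>Y. d e < k" "\<forall>i<k. even_odd {e \<in> Y. d e = i}"
    using assms unfolding decomposable_def by blast
  define g where "g e = (if e \<in> X then c e else d e)" for e
  have disj: "X \<inter> Y = {}" using dom by fast
  have "even_odd {e \<in> X \<union> Y. g e = i}" if "i < k" for i
  proof -
    let ?X = "{e \<in> X. c e = i}" and ?Y = "{e \<in> Y. d e = i}"
    have "{e \<in> X \<union> Y. g e = i} = ?X \<union> ?Y"
      using disj unfolding g_def by auto
    moreover have "even_odd (?X \<union> ?Y)"
    proof (rule even_odd_Un_vertex_disjoint)
      show "Domain ?X \<inter> Domain ?Y = {}" using dom by fast
      show "Range ?X \<inter> Range ?Y = {}" using ran by fast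
    qed (use c d that in auto)
    ultimately show ?thesis by simp
  qed
  moreover have "\<forall>e\<in>X \<union> Y. g e < k" using c d unfolding g_def by auto
  ultimately show ?thesis unfolding decomposable_def by blast
qed

section \<open>Colouring subdivided stars and forests\<close>

definition odd_fibres :: "('a \<Rightarrow> 'b) \<Rightarrow> 'a set \<Rightarrow> bool" where
  "odd_fibres f N \<longleftrightarrow> (\<forall>b\<in>f ` N. odd (card {a \<in> N. f a = b}))"

text \<open>Each \<open>a\<close> in \<open>N\<close> is the middle of a path from the centre
  \<open>v\<close> to \<open>f a\<close>. Outer ends may coincide, as \<open>f\<close> need not be
  injective; their degrees are the sizes of the fibres of \<open>f\<close>, which
  \<open>odd_fibres\<close> controls.\<close>

definition subdivided_star :: "'b \<Rightarrow> ('a \<Rightarrow> 'b) \<Rightarrow> 'a set \<Rightarrow> ('a \<times> 'b) set" where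
  "subdivided_star v f N = (\<lambda>a. (a, v)) ` N \<union> (\<lambda>a. (a, f a)) ` N"

lemma odd_verts_subdivided_star:
  assumes "\<And>a. a \<in> N \<Longrightarrow> f a \<noteq> v"
  shows "odd_verts (subdivided_star v f N) = {}"
proof -
  have "subdivided_star v f N `` {a} = (if a \<in> N then {v, f a} else {})" for a
    by (auto simp: subdivided_star_def)
  then show ?thesis using assms by (auto simp: odd_verts_def card_insert_if)
qed

lemma even_odd_subdivided_star:
  assumes "\<And>a. a \<in> N \<Longrightarrow> f a \<noteq> v" "odd_fibres f N" "N = {} \<or> odd (card N)"
  shows "even_odd (subdivided_star v f N)"
proof -
  let ?K = "subdivided_star v f N"
  have "odd_verts ?K = {}" using assms(1) by (rule odd_verts_subdivided_star)
  moreover have "odd_verts (?K\<inverse>) = Range ?K"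
  proof -
    have "odd (card (?K\<inverse> `` {b}))" if b: "b \<in> Range ?K" for b
    proof (cases "b = v")
      case True
      then have "?K\<inverse> `` {b} = N" using assms(1) by (auto simp: subdivided_star_def)
      then show ?thesis using assms(3) b by (auto simp: subdivided_star_def)
    next
      case False
      then have K: "?K\<inverse> `` {b} = {a \<in> N. f a = b}" and "b \<in> f ` N"
        using b by (auto simp: subdivided_star_def)
      then show ?thesis using assms(2) unfolding K odd_fibres_def by blast
    qed
    then have "Range ?K \<subseteq> odd_verts (?K\<inverse>)" by (auto simp: odd_verts_def)
    then show ?thesis using odd_verts_subset[of "?K\<inverse>"] by auto
  qed
  ultimately show ?thesis by (simp add: even_odd_def)
qed

lemma subdivided_star_Un:
  "subdivided_star v f (M \<union> N) = subdivided_star v f M \<union> subdivided_star v f N"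
  by (auto simp: subdivided_star_def)

lemma decomposable_subdivided_star_Un:
  assumes "decomposable even_odd j (subdivided_star v f M)" "decomposable even_odd k (subdivided_star v f N)"
    and "M \<inter> N = {}"
  shows "decomposable even_odd (j + k) (subdivided_star v f (M \<union> N))"
  unfolding subdivided_star_Un using assms
  by (intro decomposable_Un) (auto simp: subdivided_star_def)

text \<open>If the degree of the centre \<open>v\<close> is even, moving one fibre to a new colour makes it odd in both
  colours.\<close>

lemma decomposable_2_subdivided_star:
  assumes "finite N" and v: "\<And>a. a \<in> N \<Longrightarrow> f a \<noteq> v" and odd: "odd_fibres f N"
  shows "decomposable even_odd 2 (subdivided_star v f N)"
proof -
  obtain M where M: "M \<subseteq> N" "odd_fibres f M" "odd_fibres f (N - M)"
      "M = {} \<or> odd (card M)" "N - M = {} \<or> odd (card (N - M))"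
  proof (cases "N = {} \<or> odd (card N)")
    case True
    then show ?thesis using odd that[of N] by (simp add: odd_fibres_def)
  next
    case False
    then obtain x where x: "x \<in> N" by auto
    let ?M = "{a \<in> N. f a = f x}"
    have o: "odd (card ?M)" using odd x by (simp add: odd_fibres_def)
    then have "odd (card (N - ?M))"
      using False \<open>finite N\<close> card_mono[of N ?M] by (subst card_Diff_subset) auto
    moreover have "odd_fibres f ?M"
      using o by (auto simp: odd_fibres_def)
    moreover have "odd_fibres f (N - ?M)"
      unfolding odd_fibres_def
    proof
      fix b assume "b \<in> f ` (N - ?M)"
      then have B: "{a \<in> N - ?M. f a = b} = {a \<in> N. f a = b}" and "b \<in> f ` N" by auto
      then show "odd (card {a \<in> N - ?M. f a = b})"
        using odd unfolding B odd_fibres_def by blast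
    qed
    ultimately show ?thesis using o that[of ?M] by auto
  qed
  have "decomposable even_odd 1 (subdivided_star v f M)" "decomposable even_odd 1 (subdivided_star v f (N - M))"
    by (rule decomposable_1, rule even_odd_subdivided_star; use M v in blast)+
  then have "decomposable even_odd (1 + 1) (subdivided_star v f (M \<union> (N - M)))"
    by (rule decomposable_subdivided_star_Un) auto
  moreover have "M \<union> (N - M) = N" using M(1) by auto
  ultimately show ?thesis by (metis one_add_one)
qed

text \<open>One representative of every even fibre goes into \<open>M\<close>. Then \<open>M\<close>
  has fibres of size 1 and \<open>N - M\<close> odd ones, and each part takes 2 colours.\<close>

lemma decomposable_4_subdivided_star:
  assumes "finite N" and v: "\<And>a. a \<in> N \<Longrightarrow> f a \<noteq> v"
  shows "decomposable even_odd 4 (subdivided_star v f N)"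
proof -
  define rep where "rep b = (SOME a. a \<in> N \<and> f a = b)" for b
  have rep: "rep b \<in> N \<and> f (rep b) = b" if "b \<in> f ` N" for b
    unfolding rep_def by (rule someI_ex) (use that in auto)
  define M where "M = {a \<in> N. a = rep (f a) \<and> even (card {a' \<in> N. f a' = f a})}"
  have MN: "M \<subseteq> N" by (auto simp: M_def)
  have "odd_fibres f M"
    unfolding odd_fibres_def
  proof
    fix b assume "b \<in> f ` M"
    then have "{a \<in> M. f a = b} = {rep b}" by (auto simp: M_def)
    then show "odd (card {a \<in> M. f a = b})" by simp
  qed
  moreover have "odd_fibres f (N - M)"
    unfolding odd_fibres_def
  proof
    fix b assume b: "b \<in> f ` (N - M)"
    let ?B = "{a \<in> N. f a = b}"
    show "odd (card {a \<in> N - M. f a = b})"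
    proof (cases "even (card ?B)")
      case False
      then have "{a \<in> N - M. f a = b} = ?B" by (auto simp: M_def)
      then show ?thesis using False by simp
    next
      case True
      have r: "rep b \<in> ?B" using rep b by auto
      have "{a \<in> N - M. f a = b} = ?B - {rep b}"
        using True r by (auto simp: M_def)
      moreover have "card ?B = Suc (card (?B - {rep b}))"
        using r assms(1) by (intro card.remove) auto
      ultimately show ?thesis using True by simp
    qed
  qed
  ultimately have "decomposable even_odd 2 (subdivided_star v f M)"
      "decomposable even_odd 2 (subdivided_star v f (N - M))"
    using assms MN finite_subset[OF MN]
    by (auto intro!: decomposable_2_subdivided_star)
  then have "decomposable even_odd (2 + 2) (subdivided_star v f (M \<union> (N - M)))"
    by (rule decomposable_subdivided_star_Un) auto
  moreover have "M \<union> (N - M) = N" using MN by auto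
  ultimately show ?thesis by simp
qed

text \<open>Colouring an edge by its left end keeps stars whole, so left degrees stay even. With the
  actual parity of the degrees as \<open>p\<close>, a right vertex of odd degree sees a single
  colour; at one of even degree, \<open>a0\<close> is alone in its colour and the other colour gets
  an odd number of edges.\<close>

lemma forest_decomposable_2:
  fixes F :: "('a \<times> 'b) set"
  assumes fin: "finite F" and "forest F" and ev: "odd_verts F = {}"
  shows "decomposable even_odd 2 F"
proof -
  obtain x where x: "\<forall>b\<in>Range F. \<exists>a0. (a0, b) \<in> F \<and>
      (\<forall>a. (a, b) \<in> F \<and> a \<noteq> a0 \<longrightarrow> (x a \<longleftrightarrow> (x a0 \<longleftrightarrow> odd (card (F\<inverse> `` {b})))))"
    using forest_star_colouring[OF assms(1,2), of "\<lambda>b. odd (card (F\<inverse> `` {b}))"] by blast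
  have eo: "even_odd {e \<in> F. x (fst e) = \<beta>}" for \<beta>
  proof -
    let ?S = "{e \<in> F. x (fst e) = \<beta>}"
    have "?S `` {a} = (if x a = \<beta> then F `` {a} else {})" for a by auto
    then have "odd_verts ?S = {}" using ev by (simp add: odd_verts_def)
    moreover have "odd (card (?S\<inverse> `` {b}))" if b: "b \<in> Range ?S" for b
    proof -
      let ?N = "F\<inverse> `` {b}"
      have S: "?S\<inverse> `` {b} = {a \<in> ?N. x a = \<beta>}" by auto
      have "b \<in> Range F" using b by auto
      then obtain a0 where a0: "a0 \<in> ?N"
        and rest: "\<And>a. a \<in> ?N \<Longrightarrow> a \<noteq> a0 \<Longrightarrow> x a \<longleftrightarrow> (x a0 \<longleftrightarrow> odd (card ?N))"
        using x by (metis ImageI Image_singleton_iff converse_iff)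
      obtain a1 where a1: "a1 \<in> ?N" "x a1 = \<beta>" using b by auto
      show ?thesis
      proof (cases "odd (card ?N)")
        case True
        then have "x a = x a0" if "a \<in> ?N" for a using rest[OF that] by blast
        then have "{a \<in> ?N. x a = \<beta>} = ?N" using a1 by blast
        then show ?thesis using True unfolding S by simp
      next
        case False
        then have ne: "x a \<noteq> x a0" if "a \<in> ?N" "a \<noteq> a0" for a using rest[OF that] by blast
        show ?thesis
        proof (cases "x a0 = \<beta>")
          case True
          then have "{a \<in> ?N. x a = \<beta>} = {a0}" using ne a0 by blast
          then show ?thesis unfolding S by simp
        next
          case neq: False
          then have "{a \<in> ?N. x a = \<beta>} = ?N - {a0}" using ne by blast
          moreover have "card ?N = Suc (card (?N - {a0}))"
            using a0 fin by (intro card.remove) auto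
          ultimately show ?thesis using False unfolding S by simp
        qed
      qed
    qed
    then have "Range ?S \<subseteq> odd_verts (?S\<inverse>)" unfolding odd_verts_def by blast
    moreover have "odd_verts (?S\<inverse>) \<subseteq> Range ?S" using odd_verts_subset[of "?S\<inverse>"] by simp
    ultimately show ?thesis by (simp add: even_odd_def)
  qed
  have "decomposable even_odd (1 + 1) ({e \<in> F. x (fst e) = True} \<union> {e \<in> F. x (fst e) = False})"
    by (intro decomposable_Un decomposable_1 eo) auto
  moreover have "{e \<in> F. x (fst e) = True} \<union> {e \<in> F. x (fst e) = False} = F" by auto
  ultimately show ?thesis by (simp only: one_add_one)
qed

section \<open>Joins with prescribed odd vertices\<close>

lemma odd_verts_sym_diff_converse:
  assumes "finite X" "finite Y"
  shows "odd_verts ((sym_diff X Y)\<inverse>) = sym_diff (odd_verts (X\<inverse>)) (odd_verts (Y\<inverse>))"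
proof -
  have "(sym_diff X Y)\<inverse> = sym_diff (X\<inverse>) (Y\<inverse>)" by auto
  then show ?thesis using assms by (simp only: odd_verts_sym_diff finite_converse)
qed

lemma odd_verts_path2:
  assumes "b \<noteq> c"
  shows "odd_verts {(a, b), (a, c)} = {}" "odd_verts ({(a, b), (a, c)}\<inverse>) = {b, c}"
proof -
  have "{(a, b), (a, c)} `` {a'} = (if a' = a then {b, c} else {})" for a' by auto
  then show "odd_verts {(a, b), (a, c)} = {}" using assms by (simp add: odd_verts_def)
  have "{(a, b), (a, c)}\<inverse> `` {d} = (if d \<in> {b, c} then {a} else {})" for d by auto
  then have "d \<in> odd_verts ({(a, b), (a, c)}\<inverse>) \<longleftrightarrow> d \<in> {b, c}" for d
    unfolding odd_verts_def by simp
  then show "odd_verts ({(a, b), (a, c)}\<inverse>) = {b, c}" by (rule set_eqI)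
qed

text \<open>A T-join, with \<open>D\<close> in the role of T. The set \<open>C\<close> restricts the
  right vertices that may be used, so that joins can avoid a deleted vertex.\<close>

definition is_join :: "('a \<times> 'b) set \<Rightarrow> 'b set \<Rightarrow> 'b set \<Rightarrow> ('a \<times> 'b) set \<Rightarrow> bool" where
  "is_join H C D J \<longleftrightarrow>
     J \<subseteq> H \<and> Range J \<subseteq> C \<and> odd_verts J = {} \<and> odd_verts (J\<inverse>) = D"

lemma is_join_empty: "is_join H C {} {}"
  by (simp add: is_join_def)

lemma is_join_mono: "is_join H C D J \<Longrightarrow> C \<subseteq> C' \<Longrightarrow> is_join H C' D J"
  unfolding is_join_def by (meson subset_trans)

lemma is_join_sym_diff:
  assumes "finite H" "is_join H C D J" "is_join H C D' J'"
  shows "is_join H C (sym_diff D D') (sym_diff J J')"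
proof -
  have J: "J \<subseteq> H" "Range J \<subseteq> C" "odd_verts J = {}" "odd_verts (J\<inverse>) = D"
    and J': "J' \<subseteq> H" "Range J' \<subseteq> C" "odd_verts J' = {}" "odd_verts (J'\<inverse>) = D'"
    using assms(2,3) by (simp_all add: is_join_def)
  have f: "finite J" "finite J'" using J(1) J'(1) assms(1) finite_subset by auto
  have "sym_diff J J' \<subseteq> H" using J(1) J'(1) by blast
  moreover have "Range (sym_diff J J') \<subseteq> C" using J(2) J'(2) by fast
  ultimately show ?thesis
    unfolding is_join_def odd_verts_sym_diff[OF f] odd_verts_sym_diff_converse[OF f] J(3,4) J'(3,4)
    by simp
qed

text \<open>Connectedness of a set of right vertices, expressed through parities instead of paths.\<close>

definition linked :: "('a \<times> 'b) set \<Rightarrow> 'b set \<Rightarrow> bool" where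
  "linked H C \<longleftrightarrow> (\<forall>u\<in>C. \<forall>w\<in>C. \<exists>J. is_join H C (sym_diff {u} {w}) J)"

text \<open>The use of \<open>sym_diff {u} {w}\<close> instead of \<open>{u, w}\<close> in
  \<open>linked\<close> lets the empty join serve for \<open>u = w\<close>.\<close>

lemma linked_singleton: "linked H {b}"
  unfolding linked_def using is_join_empty by fastforce

lemma linked_insert:
  assumes fin: "finite H" and L: "linked H C" and c: "c \<in> C" "b \<notin> C"
    and e: "(a, b) \<in> H" "(a, c) \<in> H"
  shows "linked H (insert b C)"
proof -
  have bc: "b \<noteq> c" using c by auto
  \<comment> \<open>It suffices to join every vertex to \<open>c\<close>, since \<open>c\<close>
    cancels in the symmetric difference of two such joins. For \<open>b\<close> the path through
    \<open>a\<close> does this.\<close>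
  have to_c: "\<exists>J. is_join H (insert b C) (sym_diff {u} {c}) J" if "u \<in> insert b C" for u
  proof (cases "u = b")
    case True
    have "{b, c} = sym_diff {b} {c}" using bc by auto
    then have "is_join H (insert b C) (sym_diff {b} {c}) {(a, b), (a, c)}"
      unfolding is_join_def odd_verts_path2[OF bc] using e c(1) by auto
    then show ?thesis unfolding True by (rule exI)
  next
    case False
    then have "u \<in> C" using that by simp
    then obtain J where "is_join H C (sym_diff {u} {c}) J"
      using L c(1) unfolding linked_def by metis
    then show ?thesis using is_join_mono by (metis subset_insertI)
  qed
  show ?thesis
    unfolding linked_def
  proof (intro ballI)
    fix u w assume "u \<in> insert b C" "w \<in> insert b C"
    then obtain J K where "is_join H (insert b C) (sym_diff {u} {c}) J"
      "is_join H (insert b C) (sym_diff {w} {c}) K"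
      using to_c by metis
    then have "is_join H (insert b C)
        (sym_diff (sym_diff {u} {c}) (sym_diff {w} {c})) (sym_diff J K)"
      by (rule is_join_sym_diff[OF fin])
    moreover have "sym_diff (sym_diff {u} {c}) (sym_diff {w} {c}) = sym_diff {u} {w}" by auto
    ultimately show "\<exists>J. is_join H (insert b C) (sym_diff {u} {w}) J" by metis
  qed
qed

text \<open>Split \<open>D\<close> into pairs, join each pair, and add the joins modulo 2.\<close>

lemma linked_join:
  assumes fin: "finite H" and L: "linked H C"
    and "finite D" "D \<subseteq> C" "even (card D)"
  shows "\<exists>J. is_join H C D J"
  using assms(3-5)
proof (induction "card D" arbitrary: D rule: less_induct)
  case less
  show ?case
  proof (cases "D = {}")
    case True
    then show ?thesis using is_join_empty by metis
  next
    case False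
    then obtain u where u: "u \<in> D" by auto
    have D1: "card D = Suc (card (D - {u}))" using u less.prems by (intro card.remove) auto
    then have "card (D - {u}) \<noteq> 0" using less.prems by (intro notI) simp
    then obtain w where w: "w \<in> D - {u}" by (metis card.empty equals0I)
    define D' where "D' = D - {u} - {w}"
    have D2: "card (D - {u}) = Suc (card D')"
      unfolding D'_def using w less.prems by (intro card.remove) auto
    obtain J where J: "is_join H C D' J"
      using less.hyps[of D'] less.prems D1 D2 by (auto simp: D'_def)
    obtain K where K: "is_join H C (sym_diff {u} {w}) K"
      using L u w less.prems(2) unfolding linked_def by (metis DiffD1 subsetD)
    have "sym_diff D' (sym_diff {u} {w}) = D"
      unfolding D'_def using u w by auto
    then show ?thesis using is_join_sym_diff[OF fin J K] by metis
  qed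
qed

section \<open>Seven colours when all left degrees are even\<close>

text \<open>The set \<open>W\<close> is empty or consists of the deleted vertex \<open>v\<close>,
  which treats both cases at once. The colours are 1 for \<open>T\<close>, 4 for the subdivided star
  at \<open>v\<close> and 2 for the remaining forest.\<close>

lemma decomposable_7_if_join:
  assumes fin: "finite H" and ev: "odd_verts H = {}" and W: "W \<subseteq> {v}"
    and ex: "\<exists>T. is_join H (Range H - W) (Range H - W) T"
  shows "decomposable even_odd 7 H"
proof -
  let ?P = "is_join H (Range H - W) (Range H - W)"
  have "\<forall>T. ?P T \<longrightarrow> card T < Suc (card H)"
    using fin card_mono by (auto simp: is_join_def less_Suc_eq_le)
  then obtain T where T: "?P T" and max: "\<And>T'. ?P T' \<Longrightarrow> card T' \<le> card T"
    using ex ex_has_greatest_nat[of ?P _ card] by metis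
  have TH: "T \<subseteq> H" and TR: "Range T \<subseteq> Range H - W" and Tev: "odd_verts T = {}"
    and Todd: "odd_verts (T\<inverse>) = Range H - W"
    using T by (simp_all add: is_join_def)
  have finT: "finite T" using TH fin finite_subset by blast
  define Q where "Q = {e \<in> H. snd e \<notin> W} - T"
  have QH: "Q \<subseteq> H" and QT: "T \<inter> Q = {}" by (auto simp: Q_def)
  \<comment> \<open>A nonempty \<open>Z\<close> with all degrees even could be added to
    \<open>T\<close> without changing a parity, against the maximality of \<open>T\<close>.\<close>
  have "forest Q"
    unfolding forest_def
  proof (intro allI impI, elim conjE)
    fix Z assume Z: "Z \<subseteq> Q" "odd_verts Z = {}" "odd_verts (Z\<inverse>) = {}"
    have f: "finite Z" using finite_subset[OF subset_trans[OF Z(1) QH] fin] .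
    have d: "T \<inter> Z = {}" "T\<inverse> \<inter> Z\<inverse> = {}" using Z(1) QT by auto
    have "odd_verts (T \<union> Z) = {}"
      using Tev Z(2) by (simp add: odd_verts_Un_disjoint[OF finT f d(1)])
    moreover have "odd_verts ((T \<union> Z)\<inverse>) = Range H - W"
      using Todd Z(3) odd_verts_Un_disjoint[OF _ _ d(2)] finT f by (simp add: converse_Un)
    moreover have "Range Z \<subseteq> Range H - W" using Z(1) unfolding Q_def by fastforce
    ultimately have "?P (T \<union> Z)"
      using TH TR Z(1) QH unfolding is_join_def by auto
    then have "card (T \<union> Z) \<le> card T" by (rule max)
    then show "Z = {}" using f finT d(1) by (simp add: card_Un_disjoint)
  qed
  have T_eo: "even_odd T"
    using Tev Todd TR odd_verts_subset[of "T\<inverse>"] by (auto simp: even_odd_def)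
  \<comment> \<open>The neighbours of \<open>v\<close> if \<open>W = {v}\<close>; otherwise
    \<open>N\<close> and hence \<open>K\<close> are empty.\<close>
  define N where "N = {a. \<exists>w\<in>W. (a, w) \<in> H}"
  have av: "(a, v) \<in> H - T" "v \<in> W" if "a \<in> N" for a
    using that W TR unfolding N_def by auto
  \<comment> \<open>The degree of \<open>a\<close> in \<open>H - T\<close> is even, so its edge to
    \<open>v\<close> is not the only one there.\<close>
  have "\<exists>b. b \<noteq> v \<and> (a, b) \<in> H - T" if "a \<in> N" for a
  proof (rule ccontr)
    assume "\<not> ?thesis"
    then have "(H - T) `` {a} = {v}" using av(1)[OF that] by auto
    then have "a \<in> odd_verts (H - T)" by (simp add: odd_verts_def)
    then show False using odd_verts_Diff[OF fin TH] ev Tev by simp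
  qed
  then obtain f where f: "\<And>a. a \<in> N \<Longrightarrow> f a \<noteq> v \<and> (a, f a) \<in> H - T" by metis
  define K where "K = subdivided_star v f N"
  have KH: "K \<subseteq> H - T" using f av by (auto simp: K_def subdivided_star_def)
  have "N \<subseteq> Domain H" by (auto simp: N_def)
  then have "finite N" using fin finite_Domain finite_subset by blast
  then have K4: "decomposable even_odd 4 K"
    unfolding K_def using f by (intro decomposable_4_subdivided_star) auto
  define F where "F = (H - T) - K"
  have Kev: "odd_verts K = {}"
    unfolding K_def using f by (intro odd_verts_subdivided_star) auto
  have "odd_verts F = {}"
    unfolding F_def using odd_verts_Diff[OF _ KH] odd_verts_Diff[OF fin TH] fin ev Tev Kev
    by simp
  \<comment> \<open>All edges of \<open>H\<close> with right end in \<open>W\<close> belong to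
    \<open>K\<close>.\<close>
  moreover have "F \<subseteq> Q"
  proof
    fix e assume e: "e \<in> F"
    obtain a b where ab: "e = (a, b)" by (cases e)
    have "b \<notin> W"
    proof
      assume b: "b \<in> W"
      then have "a \<in> N" "b = v" using e ab W by (auto simp: N_def F_def)
      then have "e \<in> K" by (simp add: K_def subdivided_star_def ab)
      then show False using e by (simp add: F_def)
    qed
    then show "e \<in> Q" using e by (simp add: F_def Q_def ab)
  qed
  moreover have "finite F" using fin by (simp add: F_def)
  ultimately have F2: "decomposable even_odd 2 F"
    using forest_decomposable_2 forest_subset[OF \<open>forest Q\<close>] by blast
  have "decomposable even_odd (1 + (2 + 4)) (T \<union> (F \<union> K))"
    using KH by (intro decomposable_Un decomposable_1[of even_odd, OF T_eo] F2 K4) (auto simp: F_def)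
  moreover have "T \<union> (F \<union> K) = H" using KH TH by (auto simp: F_def)
  ultimately show ?thesis by simp
qed

text \<open>The predicate \<open>P\<close> serves to maximise over proper subsets of \<open>R\<close>: if the maximal set is not a union
  of components, it misses exactly one vertex, and this vertex can be deleted without disconnecting
  the rest.\<close>

lemma ex_maximal_linked:
  assumes "finite R" "b \<in> R" "P {b}"
  obtains C where "C \<subseteq> R" "P C" "linked H C" "C \<noteq> {}"
    "\<And>b. b \<in> R - C \<Longrightarrow> P (insert b C) \<Longrightarrow> \<not> linked H (insert b C)"
proof -
  let ?P = "\<lambda>C. C \<subseteq> R \<and> P C \<and> linked H C"
  have "?P {b}" using assms by (simp add: linked_singleton)
  moreover have "\<forall>C. ?P C \<longrightarrow> card C < Suc (card R)"
    using assms(1) card_mono by (auto simp: less_Suc_eq_le)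
  ultimately obtain C where C: "?P C" and max: "\<And>C'. ?P C' \<Longrightarrow> card C' \<le> card C"
    using ex_has_greatest_nat[of ?P "{b}" card] by metis
  have fin: "finite C" using C assms(1) finite_subset by blast
  have "card {b} \<le> card C" using max[OF \<open>?P {b}\<close>] .
  then have "C \<noteq> {}" by auto
  moreover have "\<not> linked H (insert b C)" if b: "b \<in> R - C" "P (insert b C)" for b
  proof
    assume "linked H (insert b C)"
    then have "card (insert b C) \<le> card C" using C b by (intro max) auto
    then show False using b fin by simp
  qed
  ultimately show thesis using C that by blast
qed

text \<open>The hypothesis \<open>conn\<close> is connectedness, in terms of steps between right
  vertices with a common left neighbour. By \<open>linked_insert\<close>, a maximal linked set is
  closed under these steps.\<close>

lemma linked_Range:
  assumes fin: "finite H"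
    and conn: "\<And>C. C \<subseteq> Range H \<Longrightarrow> C \<noteq> {} \<Longrightarrow>
      (\<And>a b c. (a, b) \<in> H \<Longrightarrow> (a, c) \<in> H \<Longrightarrow> c \<in> C \<Longrightarrow> b \<in> C) \<Longrightarrow> C = Range H"
  shows "linked H (Range H)"
proof (cases "Range H = {}")
  case True
  then show ?thesis by (simp add: linked_def)
next
  case False
  then obtain b where "b \<in> Range H" by blast
  then obtain C where C: "C \<subseteq> Range H" "linked H C" "C \<noteq> {}"
    "\<And>b. b \<in> Range H - C \<Longrightarrow> \<not> linked H (insert b C)"
    using ex_maximal_linked[of "Range H" b "\<lambda>_. True" H] fin finite_Range by metis
  have "C = Range H"
  proof (rule conn[OF C(1,3)])
    fix a b c assume *: "(a, b) \<in> H" "(a, c) \<in> H" "c \<in> C"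
    show "b \<in> C"
    proof (rule ccontr)
      assume "b \<notin> C"
      then show False using linked_insert[OF fin C(2) *(3) _ *(1,2)] C(4)[of b] * by blast
    qed
  qed
  then show ?thesis using C(2) by simp
qed

lemma decomposable_7:
  assumes "finite H" "odd_verts H = {}"
  shows "decomposable even_odd 7 H"
  using assms
proof (induction "card H" arbitrary: H rule: less_induct)
  case less
  note fin = less.prems(1) and ev = less.prems(2)
  show ?case
  proof (cases "H = {}")
    case True
    then show ?thesis by (simp add: decomposable_empty)
  next
    case False
    then obtain a0 b0 where a0: "(a0, b0) \<in> H" by auto
    \<comment> \<open>If \<open>b0\<close> were the only right vertex, \<open>a0\<close> would have
      degree 1. So \<open>{b0}\<close> is a proper subset from which to maximise.\<close>
    have "Range H \<noteq> {b0}"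
    proof
      assume "Range H = {b0}"
      then have "H `` {a0} = {b0}" using a0 by blast
      then have "a0 \<in> odd_verts H" by (simp add: odd_verts_def)
      then show False using ev by simp
    qed
    moreover have "b0 \<in> Range H" using a0 by blast
    ultimately obtain C where C: "C \<subseteq> Range H" "C \<noteq> Range H" "linked H C" "C \<noteq> {}"
      and max: "\<And>b. b \<in> Range H - C \<Longrightarrow> insert b C \<noteq> Range H \<Longrightarrow> \<not> linked H (insert b C)"
      using ex_maximal_linked[of "Range H" b0 "\<lambda>C. C \<noteq> Range H" H] fin finite_Range by metis
    show ?thesis
    proof (cases "\<exists>a b c. (a, b) \<in> H \<and> (a, c) \<in> H \<and> c \<in> C \<and> b \<notin> C")
      case True
      then obtain a b c where abc: "(a, b) \<in> H" "(a, c) \<in> H" "c \<in> C" "b \<notin> C" by blast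
      have L: "linked H (insert b C)" using linked_insert[OF fin C(3) abc(3,4,1,2)] .
      \<comment> \<open>By maximality \<open>C\<close> misses only \<open>b\<close>, and
        \<open>C\<close> is linked. If \<open>card C\<close> is even, \<open>b\<close> is deleted;
        otherwise the number of all right vertices is even.\<close>
      then have R: "Range H = insert b C" using max[of b] abc by blast
      have finC: "finite C" using C(1) fin finite_Range finite_subset by blast
      show ?thesis
      proof (cases "even (card C)")
        case True
        have "Range H - {b} = C" using R abc(4) by simp
        then have "\<exists>T. is_join H (Range H - {b}) (Range H - {b}) T"
          using linked_join[OF fin C(3) finC _ True] by simp
        then show ?thesis by (rule decomposable_7_if_join[OF fin ev subset_refl])
      next
        case False
        then have "even (card (insert b C))" using abc(4) finC by simp
        then have "\<exists>T. is_join H (Range H - {}) (Range H - {}) T"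
          using linked_join[OF fin L _ subset_refl] finC unfolding R by simp
        then show ?thesis by (rule decomposable_7_if_join[OF fin ev empty_subsetI])
      qed
    next
      case False
      \<comment> \<open>No left vertex has neighbours both inside and outside \<open>C\<close>, so
        \<open>X\<close> and \<open>Y\<close> share no vertex. Both are smaller than
        \<open>H\<close>, and they can use the same seven colours.\<close>
      define X where "X = {e \<in> H. snd e \<in> C}"
      define Y where "Y = {e \<in> H. snd e \<notin> C}"
      have H: "H = X \<union> Y" by (auto simp: X_def Y_def)
      have dom: "Domain X \<inter> Domain Y = {}"
      proof (rule equals0I)
        fix a assume "a \<in> Domain X \<inter> Domain Y"
        then obtain b c where "(a, c) \<in> X" "(a, b) \<in> Y" by blast
        with False show False unfolding X_def Y_def by auto
      qed
      have ran: "Range X \<inter> Range Y = {}" by (auto simp: X_def Y_def)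
      have "odd_verts X \<union> odd_verts Y = {}"
        using ev odd_verts_Un_vertex_disjoint[OF dom] unfolding H by simp
      moreover have XY: "X \<subseteq> H" "Y \<subseteq> H" by (auto simp: X_def Y_def)
      moreover obtain b c where "b \<in> Range H - C" "c \<in> C" using C by blast
      then obtain a a' where "(a, b) \<in> H - X" "(a', c) \<in> H - Y"
        using C(1) by (auto simp: X_def Y_def)
      then have "X \<noteq> H" "Y \<noteq> H" by blast+
      then have "card X < card H" "card Y < card H"
        using XY by (auto intro!: psubset_card_mono[OF fin])
      moreover have "finite X" "finite Y" using XY fin finite_subset by auto
      ultimately have "decomposable even_odd 7 X" "decomposable even_odd 7 Y" using less.hyps by simp_all
      then show ?thesis unfolding H by (rule decomposable_Un_vertex_disjoint[OF _ _ dom ran])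
    qed
  qed
qed

section \<open>Reduction to even left degrees, and passage to edge sets\<close>

text \<open>A smallest join is a forest: removing a nonempty subgraph with all degrees even would
  give a smaller join.\<close>

lemma ex_forest_join:
  assumes fin: "finite H" and ex: "is_join H C D J0"
  obtains J where "is_join H C D J" "forest J"
proof -
  obtain J where J: "is_join H C D J"
    and min: "\<And>J'. is_join H C D J' \<Longrightarrow> card J \<le> card J'"
    using ex_has_least_nat[of "is_join H C D" J0 card] ex by metis
  have JH: "J \<subseteq> H" and JC: "Range J \<subseteq> C" and "odd_verts J = {}" and "odd_verts (J\<inverse>) = D"
    using J by (simp_all add: is_join_def)
  have finJ: "finite J" using JH fin finite_subset by blast
  have "forest J"
    unfolding forest_def
  proof (intro allI impI, elim conjE)
    fix Z assume Z: "Z \<subseteq> J" "odd_verts Z = {}" "odd_verts (Z\<inverse>) = {}"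
    have "is_join H C {} Z"
      using Z subset_trans[OF Z(1) JH] subset_trans[OF Range_mono[OF Z(1)] JC]
      by (simp add: is_join_def)
    from is_join_sym_diff[OF fin J this] have "is_join H C D (J - Z)"
      using Z(1) by (simp add: Diff_eq_empty_iff[THEN iffD2])
    then have "card J \<le> card (J - Z)" by (rule min)
    moreover have "card (J - Z) = card J - card Z" "card Z \<le> card J"
      using Z(1) finJ by (auto intro!: card_Diff_subset card_mono finite_subset[OF Z(1)])
    ultimately have "card Z = 0" by linarith
    then show "Z = {}" using finite_subset[OF Z(1) finJ] by simp
  qed
  then show thesis using J that by blast
qed

abbreviation edge_of :: "'a \<times> 'a \<Rightarrow> 'a set" where
  "edge_of p \<equiv> {fst p, snd p}"

text \<open>As the sides are disjoint, an unordered edge determines which of its ends is the left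
  one.\<close>

lemma inj_on_edge_of:
  assumes "X \<subseteq> A \<times> B" "A \<inter> B = {}"
  shows "inj_on edge_of X"
proof (rule inj_onI)
  fix p q assume "p \<in> X" "q \<in> X" and eq: "edge_of p = edge_of q"
  then have "fst p \<in> A" "snd p \<in> B" "fst q \<in> A" "snd q \<in> B" using assms(1) by auto
  then have "fst p \<noteq> snd q" "snd p \<noteq> fst q" using assms(2) by auto
  then show "p = q" using eq by (auto simp: doubleton_eq_iff prod_eq_iff)
qed

lemma degree_edge_of:
  assumes X: "X \<subseteq> A \<times> B" and AB: "A \<inter> B = {}" and a: "a \<in> A"
  shows "degree (edge_of ` X) a = card (X `` {a})"
proof -
  have "{e \<in> edge_of ` X. a \<in> e} = (\<lambda>b. {a, b}) ` (X `` {a})"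
  proof (intro equalityI subsetI)
    fix e assume "e \<in> {e \<in> edge_of ` X. a \<in> e}"
    then obtain x y where xy: "(x, y) \<in> X" "e = {x, y}" "a \<in> {x, y}" by auto
    then have "y \<noteq> a" using X AB a by blast
    then have "x = a" using xy(3) by simp
    then show "e \<in> (\<lambda>b. {a, b}) ` (X `` {a})" using xy by blast
  next
    fix e assume "e \<in> (\<lambda>b. {a, b}) ` (X `` {a})"
    then obtain b where "(a, b) \<in> X" "e = {a, b}" by blast
    then show "e \<in> {e \<in> edge_of ` X. a \<in> e}" by force
  qed
  moreover have "inj_on (\<lambda>b. {a, b}) (X `` {a})"
    by (auto simp: inj_on_def doubleton_eq_iff)
  ultimately show ?thesis by (simp add: degree_def card_image)
qed

lemma edge_of_converse: "edge_of ` (X\<inverse>) = edge_of ` X"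
  by (force simp: insert_commute)

lemma locally_irregular_even_odd:
  assumes X: "X \<subseteq> A \<times> B" and AB: "A \<inter> B = {}" and eo: "even_odd X"
  shows "locally_irregular (edge_of ` X)"
  unfolding locally_irregular_def
proof (intro allI impI)
  fix u w assume "{u, w} \<in> edge_of ` X"
  then obtain a b where ab: "(a, b) \<in> X" "{u, w} = {a, b}" by auto
  have "degree (edge_of ` X) a = card (X `` {a})"
    using ab(1) X by (intro degree_edge_of[OF X AB]) auto
  \<comment> \<open>A right degree is a left degree of the converse, with \<open>A\<close> and
    \<open>B\<close> exchanged.\<close>
  moreover have "degree (edge_of ` (X\<inverse>)) b = card (X\<inverse> `` {b})"
    using ab(1) X AB by (intro degree_edge_of[of _ B A]) auto
  moreover have "even (card (X `` {a}))" "odd (card (X\<inverse> `` {b}))"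
    using eo ab(1) unfolding even_odd_def odd_verts_def by blast+
  ultimately have "degree (edge_of ` X) a \<noteq> degree (edge_of ` X) b"
    unfolding edge_of_converse by metis
  then show "degree (edge_of ` X) u \<noteq> degree (edge_of ` X) w"
    using ab(2) by (auto simp: doubleton_eq_iff)
qed

text \<open>The converse appears because \<open>linked\<close> concerns right vertices, whereas the
  vertices to be joined later are on the left.\<close>

lemma linked_Domain_if_connected:
  assumes fin: "finite G" and GAB: "G \<subseteq> A \<times> B" and AB: "A \<inter> B = {}"
    and conn: "\<And>u w. u \<in> A \<Longrightarrow> w \<in> A \<Longrightarrow> (u, w) \<in> (G \<union> G\<inverse>)\<^sup>*"
  shows "linked (G\<inverse>) (Domain G)"
proof -
  have "linked (G\<inverse>) (Range (G\<inverse>))"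
  proof (rule linked_Range)
    show "finite (G\<inverse>)" using fin by simp
    fix C assume CG: "C \<subseteq> Range (G\<inverse>)" and "C \<noteq> {}"
      and cl: "\<And>b a c. (b, a) \<in> G\<inverse> \<Longrightarrow> (b, c) \<in> G\<inverse> \<Longrightarrow> c \<in> C \<Longrightarrow> a \<in> C"
    obtain c where c: "c \<in> C" using \<open>C \<noteq> {}\<close> by blast
    have CA: "C \<subseteq> A" using CG GAB by auto
    \<comment> \<open>A walk from \<open>c\<close> alternates between \<open>C\<close> and its
      neighbours; it cannot leave them since \<open>C\<close> is closed under common
      neighbours.\<close>
    have reach: "y \<in> C \<union> G `` C" if "(c, y) \<in> (G \<union> G\<inverse>)\<^sup>*" for y
      using that
    proof induction
      case base
      then show ?case using c by simp
    next
      case (step y z)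
      show ?case
      proof (cases "y \<in> C")
        case True
        then have "y \<notin> B" using CA AB by blast
        then have "(y, z) \<in> G" using step.hyps(2) GAB by blast
        then show ?thesis using True by blast
      next
        case False
        then obtain d where d: "d \<in> C" "(d, y) \<in> G" using step.IH by blast
        then have "y \<notin> A" using GAB AB by blast
        then have "(z, y) \<in> G" using step.hyps(2) GAB by blast
        then show ?thesis using cl[of y z d] d by simp
      qed
    qed
    have "a \<in> C" if "a \<in> Range (G\<inverse>)" for a
    proof -
      have "a \<in> A" using that GAB by auto
      then have "a \<in> C \<union> G `` C" using reach conn[of c a] c CA by blast
      moreover have "a \<notin> G `` C" using \<open>a \<in> A\<close> GAB AB by blast
      ultimately show ?thesis by blast
    qed
    then show "C = Range (G\<inverse>)" using CG by blast
  qed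
  then show ?thesis by simp
qed

text \<open>As \<open>card G\<close> is even, \<open>G\<close> has an even number of left vertices
  of odd degree, so they have a join. Removing it makes all left degrees even. The join itself has
  even degrees on the right, so \<open>J\<close> is directed from right to left.\<close>

lemma decomposition_9:
  assumes fin: "finite G" and GAB: "G \<subseteq> A \<times> B" and AB: "A \<inter> B = {}"
    and conn: "\<And>u w. u \<in> A \<Longrightarrow> w \<in> A \<Longrightarrow> (u, w) \<in> (G \<union> G\<inverse>)\<^sup>*"
    and even: "even (card G)"
  obtains H J where "G = H \<union> J\<inverse>" "H \<inter> J\<inverse> = {}" "decomposable even_odd 7 H" "decomposable even_odd 2 J"
proof -
  have fin': "finite (G\<inverse>)" using fin by simp
  have "finite (odd_verts G)"
    using odd_verts_subset finite_Domain[OF fin] by (rule finite_subset)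
  then obtain J0 where "is_join (G\<inverse>) (Domain G) (odd_verts G) J0"
    using linked_join[OF fin' linked_Domain_if_connected[OF fin GAB AB conn] _ odd_verts_subset]
      even even_card_odd_verts[OF fin] by blast
  then obtain J where J: "is_join (G\<inverse>) (Domain G) (odd_verts G) J" and "forest J"
    using ex_forest_join[OF fin'] by metis
  have JG: "J \<subseteq> G\<inverse>" and Jev: "odd_verts J = {}" and Jodd: "odd_verts (J\<inverse>) = odd_verts G"
    using J by (simp_all add: is_join_def)
  have JG': "J\<inverse> \<subseteq> G" using JG by auto
  have "odd_verts (G - J\<inverse>) = {}"
    unfolding odd_verts_Diff[OF fin JG'] Jodd by simp
  then have "decomposable even_odd 7 (G - J\<inverse>)" using fin by (intro decomposable_7) auto
  moreover have "decomposable even_odd 2 J"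
    using forest_decomposable_2[OF finite_subset[OF JG fin'] \<open>forest J\<close> Jev] .
  moreover have "G = (G - J\<inverse>) \<union> J\<inverse>" using JG' by blast
  ultimately show thesis using that[of "G - J\<inverse>" J] by blast
qed

lemma decomposable_locally_irregular:
  assumes XAB: "X \<subseteq> A \<times> B" and AB: "A \<inter> B = {}" and "decomposable even_odd k X"
  shows "decomposable locally_irregular k (edge_of ` X)"
proof -
  obtain c where c: "\<forall>e\<in>X. c e < k" "\<forall>i<k. even_odd {e \<in> X. c e = i}"
    using assms(3) unfolding decomposable_def by blast
  define d where "d e = c (inv_into X edge_of e)" for e
  have d: "d (edge_of p) = c p" if "p \<in> X" for p
    unfolding d_def using inv_into_f_f[OF inj_on_edge_of[OF XAB AB] that] by simp
  have "locally_irregular {e \<in> edge_of ` X. d e = i}" if "i < k" for i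
  proof -
    have "{e \<in> edge_of ` X. d e = i} = edge_of ` {p \<in> X. c p = i}" using d by auto
    moreover have "{p \<in> X. c p = i} \<subseteq> A \<times> B" using XAB by auto
    ultimately show ?thesis using locally_irregular_even_odd[OF _ AB] c(2) that by simp
  qed
  moreover have "\<forall>e\<in>edge_of ` X. d e < k" using c(1) d by simp
  ultimately show ?thesis unfolding decomposable_def by blast
qed

theorem theorem16:
  fixes V :: "'a set" and E :: "'a set set"
  assumes "fin_simple_graph V E"
    and "graph_connected V E"
    and "graph_bipartite V E"
    and "even (card E)"
  shows "irr_chromatic_index E \<le> 9"
proof -
  obtain A B where V: "A \<union> B = V" and AB: "A \<inter> B = {}"
    and E: "\<forall>e\<in>E. \<exists>a\<in>A. \<exists>b\<in>B. e = {a, b}"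
    using assms(3) unfolding graph_bipartite_def by metis
  define G where "G = {(a, b). a \<in> A \<and> b \<in> B \<and> {a, b} \<in> E}"
  have GAB: "G \<subseteq> A \<times> B" by (auto simp: G_def)
  have EG: "E = edge_of ` G"
  proof
    show "E \<subseteq> edge_of ` G"
    proof
      fix e assume e: "e \<in> E"
      then obtain a b where "a \<in> A" "b \<in> B" "e = {a, b}" using E by metis
      then show "e \<in> edge_of ` G" using e by (intro image_eqI[of _ _ "(a, b)"]) (auto simp: G_def)
    qed
  qed (auto simp: G_def)
  have "finite V" using assms(1) by (rule fin_simple_graph.finite_vertices)
  then have fin: "finite G" using V by (intro finite_subset[OF GAB]) auto
  \<comment> \<open>Walks in the graph become walks along \<open>G\<close> and its converse.\<close>
  have "{(x, y). {x, y} \<in> E} \<subseteq> G \<union> G\<inverse>"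
  proof (rule subrelI)
    fix x y assume "(x, y) \<in> {(x, y). {x, y} \<in> E}"
    then have xy: "{x, y} \<in> E" by simp
    then obtain a b where "a \<in> A" "b \<in> B" "{x, y} = {a, b}" using E by metis
    then show "(x, y) \<in> G \<union> G\<inverse>"
      using xy by (auto simp: G_def doubleton_eq_iff insert_commute)
  qed
  then have conn: "(u, w) \<in> (G \<union> G\<inverse>)\<^sup>*" if "u \<in> A" "w \<in> A" for u w
    using assms(2) V that rtrancl_mono unfolding graph_connected_def by blast
  have "even (card G)"
    using assms(4) card_image[OF inj_on_edge_of[OF GAB AB]] unfolding EG by simp
  then obtain H J where HJ: "G = H \<union> J\<inverse>" "H \<inter> J\<inverse> = {}"
    and dec: "decomposable even_odd 7 H" "decomposable even_odd 2 J"
    using decomposition_9[OF fin GAB AB conn] by metis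
  \<comment> \<open>The pairs of \<open>J\<close> lead from \<open>B\<close> to \<open>A\<close>, so
    the two sides are exchanged for it.\<close>
  have "H \<subseteq> A \<times> B" "J \<subseteq> B \<times> A" using HJ(1) GAB by auto
  then have "decomposable locally_irregular 7 (edge_of ` H)"
      "decomposable locally_irregular 2 (edge_of ` (J\<inverse>))"
    using decomposable_locally_irregular[OF _ AB dec(1)]
      decomposable_locally_irregular[of J B A, OF _ _ dec(2)] AB
    unfolding edge_of_converse by (simp_all add: Int_commute)
  moreover have "edge_of ` H \<inter> edge_of ` (J\<inverse>) = {}"
    using inj_on_image_Int[OF inj_on_edge_of[OF GAB AB], of H "J\<inverse>"] HJ by auto
  ultimately have "decomposable locally_irregular (7 + 2) (edge_of ` H \<union> edge_of ` (J\<inverse>))"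
    by (rule decomposable_Un)
  moreover have "edge_of ` H \<union> edge_of ` (J\<inverse>) = E"
    unfolding EG HJ(1) image_Un ..
  ultimately have "\<exists>c. locally_irregular_colouring E 9 c"
    by (simp add: decomposable_def locally_irregular_colouring_def)
  then have "irr_chromatic_index E \<le> enat 9"
    unfolding irr_chromatic_index_def by (intro INF_lower) simp
  then show ?thesis by (simp add: numeral_eq_enat)
qed

end
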